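(* Let $n\ge p$ be positive integers, let $\mathbb{E}$ be a finite-dimensional Euclidean space, let $\mathcal{A}:\mathbb{R}^{n\times p}\to\mathbb{E}$ be linear and $b\in\mathbb{E}$. Let $\bar X$ be a solution of $$\min_{X\in\mathbb{R}^{n\times p}}\|X\|_*\quad\text{s.t.}\quad\mathcal{A}(X)=b$$ such that (i) $\operatorname{ri}(\partial\|\cdot\|_*(\bar X))\cap\operatorname{rge}\mathcal{A}^*\neq\emptyset$, and (ii) $\operatorname{par}(\partial\|\cdot\|_*(\bar X))+\operatorname{rge}\mathcal{A}^*=\mathbb{R}^{n\times p}$. Then $\bar X$ is the unique solution of this minimization problem.
   Context: $\mathbb{R}^{n\times p}$ carries the inner product $\langle X,Y\rangle=\operatorname{tr}(X^TY)$; $\mathcal{A}^*$ is the adjoint of $\mathcal{A}$ and $\operatorname{rge}\mathcal{A}^*$ its range. $\|\cdot\|_*$ is the nuclear norm (sum of singular values). $\partial\|\cdot\|_*(\bar X)=\{Y: \|\bar X\|_*+\langle Y,X-\bar X\rangle\le \|X\|_*\ \forall X\in\mathbb{R}^{n\times p}\}$ is the convex subdifferential. For a nonempty convex set $C$, $\operatorname{ri}C$ is its relative interior (interior relative to the affine hull $\operatorname{aff}C$) and $\operatorname{par}C=\operatorname{aff}C-x$ (any $x\in C$) is the subspace parallel to $C$. *)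

theory Defs
  imports "HOL-Analysis.Analysis"
begin

lemma inner_matrix_eq_trace:
  fixes X Y :: "real ^ 'p ^ 'n"
  shows "X \<bullet> Y = trace (transpose X ** Y)"
  unfolding inner_vec_def trace_def matrix_matrix_mult_def transpose_def
  by (simp add: sum.swap[of _ "UNIV :: 'n set"])

definition right_singular_space :: "real ^ 'p ^ 'n \<Rightarrow> real \<Rightarrow> (real ^ 'p) set" where
  "right_singular_space X \<sigma> = {v. (transpose X ** X) *v v = \<sigma>\<^sup>2 *\<^sub>R v}"

definition singular_values :: "real ^ 'p ^ 'n \<Rightarrow> real set" where
  "singular_values X = {\<sigma>. 0 \<le> \<sigma> \<and> (\<exists>v \<in> right_singular_space X \<sigma>. v \<noteq> 0)}"

text \<open>The singular values are the nonnegative square roots of the eigenvalues of $X^T X$.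
  In the nuclear norm each of them is counted with its multiplicity, which for the symmetric
  matrix $X^T X$ is the dimension of the eigenspace.\<close>

definition nuclear_norm :: "real ^ 'p ^ 'n \<Rightarrow> real" where
  "nuclear_norm X = (\<Sum>\<sigma> \<in> singular_values X. real (dim (right_singular_space X \<sigma>)) * \<sigma>)"

text \<open>The index set of the sum above is finite, so the sum is not the default value 0.\<close>

lemma finite_singular_values:
  fixes X :: "real ^ 'p ^ 'n"
  shows "finite (singular_values X)"
proof -
  let ?M = "transpose X ** X"
  have sym: "(?M *v v) \<bullet> w = v \<bullet> (?M *v w)" for v w
    by (metis dot_lmul_matrix matrix_transpose_mul transpose_matrix_vector transpose_transpose)
  obtain e where e: "e \<sigma> \<in> right_singular_space X \<sigma>" "e \<sigma> \<noteq> 0"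
    if "\<sigma> \<in> singular_values X" for \<sigma>
  proof -
    have "\<forall>\<sigma>. \<exists>v. \<sigma> \<in> singular_values X \<longrightarrow> v \<in> right_singular_space X \<sigma> \<and> v \<noteq> 0"
      by (auto simp: singular_values_def)
    then show thesis
      by (metis that)
  qed
  have orth: "e \<sigma> \<bullet> e \<tau> = 0"
    if "\<sigma> \<in> singular_values X" "\<tau> \<in> singular_values X" "\<sigma> \<noteq> \<tau>" for \<sigma> \<tau>
  proof -
    have "\<sigma>\<^sup>2 * (e \<sigma> \<bullet> e \<tau>) = \<tau>\<^sup>2 * (e \<sigma> \<bullet> e \<tau>)"
      using sym[of "e \<sigma>" "e \<tau>"] e(1)[OF that(1)] e(1)[OF that(2)]
      by (simp add: right_singular_space_def)
    moreover have "\<sigma>\<^sup>2 \<noteq> \<tau>\<^sup>2"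
      using that by (simp add: singular_values_def power2_eq_iff_nonneg)
    ultimately show ?thesis by simp
  qed
  have inj: "inj_on e (singular_values X)"
    using orth e(2) by (metis inj_onI inner_eq_zero_iff)
  have "pairwise orthogonal (e ` singular_values X)"
    using orth by (auto simp: pairwise_def orthogonal_def)
  then have "independent (e ` singular_values X)"
    using e(2) by (intro pairwise_orthogonal_independent) auto
  then show ?thesis
    using inj finite_imageD independent_imp_finite by blast
qed

definition subdifferential :: "('a :: real_inner \<Rightarrow> real) \<Rightarrow> 'a \<Rightarrow> 'a set" where
  "subdifferential f x = {y. \<forall>z. f x + y \<bullet> (z - x) \<le> f z}"

definition par :: "'a :: real_vector set \<Rightarrow> 'a set" where
  "par C = (\<lambda>y. y - (SOME x. x \<in> C)) ` (affine hull C)"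

lemma par_eq:
  assumes "x \<in> C"
  shows "par C = (\<lambda>y. y - x) ` (affine hull C)"
proof -
  have "(\<lambda>y. y - a) ` (affine hull C) \<subseteq> (\<lambda>y. y - b) ` (affine hull C)"
    if "a \<in> C" "b \<in> C" for a b
  proof (rule image_subsetI)
    fix y assume "y \<in> affine hull C"
    then have "y + 1 *\<^sub>R (b - a) \<in> affine hull C"
      using that by (simp only: mem_affine_3_minus[OF affine_affine_hull] hull_inc)
    then show "y - a \<in> (\<lambda>y. y - b) ` (affine hull C)"
      by (intro image_eqI[of _ _ "y + 1 *\<^sub>R (b - a)"]) simp_all
  qed
  moreover have "(SOME x. x \<in> C) \<in> C"
    using assms by (rule someI)
  ultimately show ?thesis
    unfolding par_def using assms by (intro subset_antisym) blast+
qed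

end

theory Submission
  imports Defs
begin

text \<open>Let \<open>X\<close> be a second solution and \<open>H = X - Xbar\<close>. Every \<open>Y\<close> in the subdifferential at
  \<open>Xbar\<close> satisfies \<open>Y \<bullet> H \<le> 0\<close>, since \<open>X\<close> and \<open>Xbar\<close> have the same objective value, with equality
  on \<open>rge \<A>\<^sup>*\<close>, since \<open>\<A> H = 0\<close>. By (i) the functional \<open>Y \<mapsto> Y \<bullet> H\<close> thus attains its maximum over
  the subdifferential at a relative interior point, hence is constant there, that is, \<open>H\<close> is
  orthogonal to the parallel subspace. It is also orthogonal to \<open>rge \<A>\<^sup>*\<close>, so \<open>H = 0\<close> by (ii).\<close>

text \<open>Around \<open>y\<close> there is room in \<open>C\<close> to move both ways along
  \<open>w - y\<close>; maximality in both directions forces zero slope.\<close>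

lemma inner_eq_on_affine_hull_if_max_at_rel_interior:
  fixes C :: "'a :: euclidean_space set"
  assumes y: "y \<in> rel_interior C"
    and max: "\<And>z. z \<in> C \<Longrightarrow> z \<bullet> h \<le> y \<bullet> h"
    and w: "w \<in> affine hull C"
  shows "w \<bullet> h = y \<bullet> h"
proof (cases "w = y")
  case False
  obtain e where e: "e > 0" "cball y e \<inter> affine hull C \<subseteq> C" and "y \<in> C"
    using y by (auto simp: mem_rel_interior_cball)
  \<comment> \<open>Scaled so that \<open>y + t *\<^sub>R (w - y)\<close> and its mirror image lie
    at distance exactly \<open>e\<close> from \<open>y\<close>.\<close>
  define t where "t = e / norm (w - y)"
  have "t > 0"
    using e False by (simp add: t_def)
  have "y + s *\<^sub>R (w - y) \<in> C" if "\<bar>s\<bar> = t" for s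
  proof -
    have "y + s *\<^sub>R (w - y) \<in> affine hull C"
      using \<open>y \<in> C\<close> w by (simp add: mem_affine_3_minus[OF affine_affine_hull] hull_inc)
    moreover have "y + s *\<^sub>R (w - y) \<in> cball y e"
      using that e(1) False by (simp add: dist_norm t_def)
    ultimately show ?thesis
      using e(2) by blast
  qed
  from max[OF this[of t]] max[OF this[of "- t"]]
  have "t * (w \<bullet> h - y \<bullet> h) = 0"
    using \<open>t > 0\<close> by (simp add: inner_add_left inner_diff_left right_diff_distrib)
  with \<open>t > 0\<close> show ?thesis
    by simp
qed simp

lemma unique_minimizer_if_subdifferential_transversal:
  fixes f :: "'a :: euclidean_space \<Rightarrow> real" and \<A> :: "'a \<Rightarrow> 'e :: euclidean_space"
  assumes lin: "linear \<A>"
    and x: "is_arg_min f (\<lambda>x. \<A> x = b) x"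
    and x': "is_arg_min f (\<lambda>x. \<A> x = b) x'"
    and ri: "rel_interior (subdifferential f x) \<inter> range (adjoint \<A>) \<noteq> {}"
    and sum: "par (subdifferential f x) + range (adjoint \<A>) = UNIV"
  shows "x' = x"
proof -
  let ?C = "subdifferential f x"
  define h where "h = x' - x"
  have "f x' = f x"
    using x x' by (intro antisym) (simp_all add: is_arg_min_linorder)
  have le: "z \<bullet> h \<le> 0" if "z \<in> ?C" for z
  proof -
    have "f x + z \<bullet> (x' - x) \<le> f x'"
      using that by (simp add: subdifferential_def)
    then show ?thesis
      using \<open>f x' = f x\<close> by (simp add: h_def)
  qed
  have "\<A> h = 0"
    using x x' by (simp add: h_def linear_diff[OF lin] is_arg_min_def)
  have orth_range: "z \<bullet> h = 0" if "z \<in> range (adjoint \<A>)" for z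
    using that \<open>\<A> h = 0\<close> adjoint_works[OF lin, of h] by (auto simp: inner_commute[of _ h])
  obtain y where y: "y \<in> rel_interior ?C" "y \<in> range (adjoint \<A>)"
    using ri by blast
  have yC: "y \<in> ?C"
    using y(1) rel_interior_subset by blast
  have orth_par: "z \<bullet> h = 0" if "z \<in> par ?C" for z
  proof -
    from that[unfolded par_eq[OF yC]]
    obtain w where "w \<in> affine hull ?C" "z = w - y"
      by auto
    \<comment> \<open>Since \<open>y\<close> is in the range of the adjoint,
      \<open>y \<bullet> h = 0\<close>, so the bound \<open>le\<close> says that \<open>y\<close> is
      a maximizer over \<open>?C\<close>.\<close>
    moreover from this(1) have "w \<bullet> h = y \<bullet> h"
      using y(1) le orth_range[OF y(2)]
      by (intro inner_eq_on_affine_hull_if_max_at_rel_interior[of _ ?C]) simp_all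
    ultimately show ?thesis
      by (simp add: inner_diff_left)
  qed
  have "h \<in> par ?C + range (adjoint \<A>)"
    by (simp add: sum)
  then obtain u v where "h = u + v" "u \<in> par ?C" "v \<in> range (adjoint \<A>)"
    by (rule set_plus_elim)
  then have "h \<bullet> h = 0"
    by (metis inner_add_left orth_par orth_range add_0)
  then show ?thesis
    by (simp add: h_def)
qed

theorem corollary4p5:
  fixes \<A> :: "real ^ 'p ^ 'n \<Rightarrow> 'e :: euclidean_space"
    and b :: 'e
    and Xbar :: "real ^ 'p ^ 'n"
  assumes "CARD('p) \<le> CARD('n)"
    and "linear \<A>"
    and "is_arg_min nuclear_norm (\<lambda>X. \<A> X = b) Xbar"
    and "rel_interior (subdifferential nuclear_norm Xbar) \<inter> range (adjoint \<A>) \<noteq> {}"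
    and "par (subdifferential nuclear_norm Xbar) + range (adjoint \<A>) = UNIV"
  shows "\<forall>X. is_arg_min nuclear_norm (\<lambda>X. \<A> X = b) X \<longleftrightarrow> X = Xbar"
  using unique_minimizer_if_subdifferential_transversal[OF assms(2,3) _ assms(4,5)] assms(3)
  by blast

end
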